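(* Let $1<a<b<\infty$, $Q>1$, and suppose that $\nu$ is absolutely continuous with respect to Lebesgue measure on $(a,b)$ with positive, continuous, differentiable Radon–Nikodym derivative $h$, $\nu(B)=\int_Bh(p)\,dp$, where $h$ is non-negative, integrable, and continuous at the point $p=a$ or at the point $p=b$, with $h(a)>0$, $h(b)>0$. Then the Integral Grand Lebesgue Space $G^{(Q')}_{\mu,\nu}\left(b/(b-1),\,a/(a-1)\right)$ does not coincide with the dual (associate) space of $G^{(Q)}_{\mu,\nu}(a,b)$.
   Context: Let $(T,\mathcal A,\mu)$ be a measurable space with a non-trivial sigma-finite measure $\mu$ such that for every $\delta\in(0,\infty)$ there is a measurable set $A$ with $\mu(A)=\delta$ (so that fundamental functions are defined on $(0,\infty)$). For measurable $f:T\to\mathbb R$ put $|f|_p=\left(\int_T|f|^p\,d\mu\right)^{1/p}$; $Q'=Q/(Q-1)$, $p'=p/(p-1)$. The Integral Grand Lebesgue Space $Y=G^{(Q)}_{\mu,\nu}(a,b)$ is the set of all measurable $f:T\to\mathbb R$ with finite norm $\|f\|_Y=\left[\int_a^b|f|_p^Q\,\nu(dp)\right]^{1/Q}$. The space $G^{(Q')}_{\mu,\nu}(b/(b-1),a/(a-1))$ is the set of all measurable $g$ with finite norm $\|g\|_{Q'}=\left[\int_a^b|g|_{p'}^{Q'}\,\nu(dp)\right]^{1/Q'}$; note that $p'$ ranges over $(b/(b-1),a/(a-1))$ when $p$ ranges over $(a,b)$. The dual of $Y$ coincides with the associate space $Y'$, whose norm is $\|g\|_{Y'}=\sup_{\|f\|_Y=1}\left|\int_Tfg\,d\mu\right|$.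 "Coincide" means equality as normed function spaces. *)

theory Defs
  imports "HOL-Analysis.Analysis"
begin

text \<open>Only used with exponents \<open>r > 0\<close>, where \<open>0\<close> goes to \<open>0\<close> and \<open>\<infinity>\<close> to \<open>\<infinity>\<close>.\<close>

definition ennreal_powr :: "ennreal \<Rightarrow> real \<Rightarrow> ennreal" where
  "ennreal_powr x r = (if x = \<infinity> then \<infinity> else ennreal (enn2real x powr r))"

definition conj_exp :: "real \<Rightarrow> real" where
  "conj_exp p = p / (p - 1)"

definition lp_norm :: "'a measure \<Rightarrow> real \<Rightarrow> ('a \<Rightarrow> real) \<Rightarrow> ennreal" where
  "lp_norm \<mu> p f = ennreal_powr (\<integral>\<^sup>+x. ennreal (\<bar>f x\<bar> powr p) \<partial>\<mu>) (1 / p)"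

text \<open>Norms take the value \<open>\<infinity>\<close> off the space. The integral from \<open>a\<close> to \<open>b\<close> against \<open>\<nu>\<close> is
  over the open interval, so only the restriction of \<open>\<nu>\<close> to \<open>(a, b)\<close> matters. Elements of the
  spaces are functions; functions equal almost everywhere are not identified.\<close>

definition igls_norm ::
  "'a measure \<Rightarrow> real measure \<Rightarrow> real \<Rightarrow> real \<Rightarrow> real \<Rightarrow> ('a \<Rightarrow> real) \<Rightarrow> ennreal" where
  "igls_norm \<mu> \<nu> a b Q f =
     ennreal_powr (\<integral>\<^sup>+p\<in>{a<..<b}. ennreal_powr (lp_norm \<mu> p f) Q \<partial>\<nu>) (1 / Q)"

definition igls ::
  "'a measure \<Rightarrow> real measure \<Rightarrow> real \<Rightarrow> real \<Rightarrow> real \<Rightarrow> ('a \<Rightarrow> real) set" where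
  "igls \<mu> \<nu> a b Q = {f \<in> borel_measurable \<mu>. igls_norm \<mu> \<nu> a b Q f < \<infinity>}"

text \<open>The space \<open>G\<^bsup>(Q')\<^esup>(b/(b-1), a/(a-1))\<close>, with parameters the original \<open>a\<close>, \<open>b\<close>, \<open>Q\<close>: the
  integration variable is still \<open>p\<close> in \<open>(a, b)\<close>, and the Lebesgue exponent is the conjugate of \<open>p\<close>.\<close>

definition conj_igls_norm ::
  "'a measure \<Rightarrow> real measure \<Rightarrow> real \<Rightarrow> real \<Rightarrow> real \<Rightarrow> ('a \<Rightarrow> real) \<Rightarrow> ennreal" where
  "conj_igls_norm \<mu> \<nu> a b Q g =
     ennreal_powr
       (\<integral>\<^sup>+p\<in>{a<..<b}. ennreal_powr (lp_norm \<mu> (conj_exp p) g) (conj_exp Q) \<partial>\<nu>)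
       (1 / conj_exp Q)"

definition conj_igls ::
  "'a measure \<Rightarrow> real measure \<Rightarrow> real \<Rightarrow> real \<Rightarrow> real \<Rightarrow> ('a \<Rightarrow> real) set" where
  "conj_igls \<mu> \<nu> a b Q = {g \<in> borel_measurable \<mu>. conj_igls_norm \<mu> \<nu> a b Q g < \<infinity>}"

text \<open>The Bochner integral of a non-integrable function is \<open>0\<close>; such products count as \<open>\<infinity>\<close> here,
  so every \<open>g\<close> of finite norm is integrable against all of the unit sphere.\<close>

definition assoc_norm ::
  "'a measure \<Rightarrow> (('a \<Rightarrow> real) \<Rightarrow> ennreal) \<Rightarrow> ('a \<Rightarrow> real) \<Rightarrow> ennreal" where
  "assoc_norm \<mu> N g =
     (SUP f \<in> {f \<in> borel_measurable \<mu>. N f = 1}.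
        if integrable \<mu> (\<lambda>x. f x * g x) then ennreal \<bar>\<integral>x. f x * g x \<partial>\<mu>\<bar> else \<infinity>)"

definition assoc_space ::
  "'a measure \<Rightarrow> (('a \<Rightarrow> real) \<Rightarrow> ennreal) \<Rightarrow> ('a \<Rightarrow> real) set" where
  "assoc_space \<mu> N = {g \<in> borel_measurable \<mu>. assoc_norm \<mu> N g < \<infinity>}"

definition coincide ::
  "('a \<Rightarrow> real) set \<Rightarrow> (('a \<Rightarrow> real) \<Rightarrow> ennreal) \<Rightarrow>
   ('a \<Rightarrow> real) set \<Rightarrow> (('a \<Rightarrow> real) \<Rightarrow> ennreal) \<Rightarrow> bool" where
  "coincide X N X' N' \<longleftrightarrow> X = X' \<and> (\<forall>f\<in>X. N f = N' f)"

end

theory Submission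
  imports Defs
begin

text \<open>Both norms can be computed on indicators, and indicators already tell the two spaces apart.
  Let \<open>\<mu> A = d\<close>, so that \<open>|1\<^sub>A|\<^sub>p = d\<^bsup>1/p\<^esup>\<close>, and put
  \<open>\<Phi>(d) = \<integral> d\<^bsup>Q/p\<^esup> \<nu>(dp)\<close> and \<open>\<Psi>(d) = \<integral> d\<^bsup>Q'/p'\<^esup> \<nu>(dp)\<close> over \<open>(a, b)\<close>.
  The conjugate norm of \<open>1\<^sub>A\<close> is \<open>\<Psi>(d)\<^bsup>1/Q'\<^esup>\<close>. The associate norm of \<open>1\<^sub>A\<close> is
  \<open>d / \<Phi>(d)\<^bsup>1/Q\<^esup>\<close>, as in every space in which replacing \<open>f\<close> by its average over \<open>A\<close> does not
  increase the norm: the extremal \<open>f\<close> in the supremum is then a multiple of \<open>1\<^sub>A\<close>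
  (\<open>assoc_norm_indicator\<close>). If the spaces coincide, then
  \<open>\<Phi>(d)\<^bsup>1/Q\<^esup> \<Psi>(d)\<^bsup>1/Q'\<^esup> = d\<close> for every \<open>d > 0\<close>.

  This is impossible (\<open>power_moments_not_tight\<close>). For \<open>d = 1\<close> it says that \<open>\<nu>\<close> has mass \<open>1\<close> on
  \<open>(a, b)\<close>. Since \<open>d = \<integral> d\<^bsup>1/p\<^esup> d\<^bsup>1/p'\<^esup> \<nu>(dp)\<close> for such a \<open>\<nu>\<close>, the identity for any other
  \<open>d\<close> is an equality in Hoelder's inequality, and it forces \<open>d\<^bsup>Q/p\<^esup>\<close> to be constant for \<open>\<nu>\<close>-almost
  every \<open>p\<close>. Only one \<open>p\<close> can then carry mass, whereas a measure with a density has no atoms.\<close>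

section \<open>Extended powers\<close>

lemma ennreal_powr_ennreal:
  "0 \<le> x \<Longrightarrow> ennreal_powr (ennreal x) r = ennreal (x powr r)"
  by (simp add: ennreal_powr_def)

lemma ennreal_powr_mono:
  assumes "x \<le> y" "0 \<le> r"
  shows "ennreal_powr x r \<le> ennreal_powr y r"
proof (cases "y = \<infinity>")
  case False
  then obtain y' where y': "y = ennreal y'" "0 \<le> y'"
    by (cases y) (auto simp: infinity_ennreal_def)
  with assms obtain x' where x': "x = ennreal x'" "0 \<le> x'"
    by (cases x) (auto simp: infinity_ennreal_def top_unique)
  with assms y' have "x' \<le> y'"
    by simp
  then show ?thesis
    using x' y' assms by (simp add: ennreal_powr_ennreal powr_mono2)
qed (simp add: ennreal_powr_def)

section \<open>Lebesgue norms and averages over a set\<close>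

lemma nn_integral_scaled_indicator_powr:
  assumes "A \<in> sets \<mu>" "emeasure \<mu> A = ennreal d" and "0 \<le> d" "0 \<le> c" "0 < p"
  shows "(\<integral>\<^sup>+x. ennreal (\<bar>c * indicator A x\<bar> powr p) \<partial>\<mu>) = ennreal (c powr p * d)"
proof -
  have "(\<integral>\<^sup>+x. ennreal (\<bar>c * indicator A x\<bar> powr p) \<partial>\<mu>)
      = (\<integral>\<^sup>+x. ennreal (c powr p) * indicator A x \<partial>\<mu>)"
    using assms by (intro nn_integral_cong) (auto simp: indicator_def)
  then show ?thesis
    using assms by (simp add: nn_integral_cmult_indicator ennreal_mult)
qed

lemma lp_norm_scaled_indicator:
  assumes "A \<in> sets \<mu>" "emeasure \<mu> A = ennreal d" and "0 \<le> d" "0 \<le> c" "0 < p"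
  shows "lp_norm \<mu> p (\<lambda>x. c * indicator A x) = ennreal (c * d powr (1 / p))"
  unfolding lp_norm_def nn_integral_scaled_indicator_powr[OF assms]
  using assms by (simp add: ennreal_powr_ennreal powr_mult powr_powr)

text \<open>The graph of \<open>y \<mapsto> y\<^bsup>p\<^esup>\<close> lies above its tangent at \<open>c\<close>; cleared of subtraction, this can be
  integrated in the extended nonnegative reals. It is Young's inequality for \<open>y\<close> and
  \<open>c\<^bsup>p-1\<^esup>\<close>.\<close>

lemma powr_tangent_le:
  fixes c y p :: real
  assumes "1 < p" "0 < c" "0 \<le> y"
  shows "p * c powr (p - 1) * y \<le> y powr p + (p - 1) * c powr p"
proof -
  define q where "q = p / (p - 1)"
  have q: "1 < q" "1 / p + 1 / q = 1" "(p - 1) * q = p"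
    using assms by (auto simp: q_def field_simps)
  have "y * c powr (p - 1) \<le> y powr p / p + (c powr (p - 1)) powr q / q"
    using assms q by (intro Youngs_inequality) auto
  also have "(c powr (p - 1)) powr q = c powr p"
    by (simp add: powr_powr q)
  finally have "p * (y * c powr (p - 1)) \<le> p * (y powr p / p + c powr p / q)"
    using assms by (intro mult_left_mono) auto
  also have "\<dots> = y powr p + (p - 1) * c powr p"
    using assms by (simp add: q_def field_simps)
  finally show ?thesis
    by (simp add: mult_ac)
qed

text \<open>If \<open>c\<close> is at most the mean of \<open>|f|\<close> over \<open>A\<close>, then \<open>c\<^bsup>p\<^esup> d \<le> \<integral> |f|\<^bsup>p\<^esup>\<close>. This is Jensen's
  inequality, obtained by integrating the tangent inequality at \<open>c\<close> over \<open>A\<close>. A lower bound \<open>c\<close> in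
  place of the mean itself leaves room for an infinite mean.\<close>

lemma lp_norm_average_le:
  assumes A: "A \<in> sets \<mu>" "emeasure \<mu> A = ennreal d" and f: "f \<in> borel_measurable \<mu>"
    and "0 \<le> d" "0 \<le> c" "1 < p"
    and avg: "ennreal (c * d) \<le> (\<integral>\<^sup>+x. ennreal \<bar>f x\<bar> * indicator A x \<partial>\<mu>)"
  shows "lp_norm \<mu> p (\<lambda>x. c * indicator A x) \<le> lp_norm \<mu> p f"
proof (cases "c = 0")
  case True
  then show ?thesis
    using assms lp_norm_scaled_indicator[OF A, of 0 p] by simp
next
  case False
  with assms have c: "0 < c" by simp
  define W where "W = (\<integral>\<^sup>+x. ennreal (\<bar>f x\<bar> powr p) \<partial>\<mu>)"
  note [measurable] = A(1) f
  have cp: "c powr (p - 1) * c = c powr p"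
    using c powr_add[of c "p - 1" 1] by simp
  have "ennreal (c powr p * d) + ennreal ((p - 1) * c powr p * d)
      = ennreal (p * c powr (p - 1)) * ennreal (c * d)"
  proof -
    have "c powr p * d + (p - 1) * c powr p * d = p * c powr (p - 1) * (c * d)"
      unfolding cp[symmetric] by (simp only: ring_distribs mult_ac)
    then show ?thesis
      using assms c by (subst ennreal_plus[symmetric], simp, simp, subst ennreal_mult[symmetric]) auto
  qed
  also have "\<dots> \<le> ennreal (p * c powr (p - 1)) * (\<integral>\<^sup>+x. ennreal \<bar>f x\<bar> * indicator A x \<partial>\<mu>)"
    by (intro mult_left_mono avg) auto
  also have "\<dots> = (\<integral>\<^sup>+x. ennreal (p * c powr (p - 1) * \<bar>f x\<bar>) * indicator A x \<partial>\<mu>)"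
    using assms by (subst nn_integral_cmult[symmetric])
      (auto intro!: nn_integral_cong simp: ennreal_mult mult_ac)
  also have "\<dots> \<le> (\<integral>\<^sup>+x. ennreal (\<bar>f x\<bar> powr p) + ennreal ((p - 1) * c powr p) * indicator A x \<partial>\<mu>)"
    using assms c powr_tangent_le[of p c]
    by (intro nn_integral_mono) (auto simp: indicator_def simp flip: ennreal_plus intro!: ennreal_leI)
  also have "\<dots> = W + ennreal ((p - 1) * c powr p * d)"
    using assms by (subst nn_integral_add)
      (auto simp: W_def nn_integral_cmult_indicator ennreal_mult)
  finally have "ennreal ((p - 1) * c powr p * d) + ennreal (c powr p * d)
      \<le> ennreal ((p - 1) * c powr p * d) + W"
    by (simp only: add.commute)
  then have "ennreal (c powr p * d) \<le> W"
    by (simp only: ennreal_add_left_cancel_le) simp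
  then show ?thesis
    using assms nn_integral_scaled_indicator_powr[OF A, of c p]
    unfolding lp_norm_def W_def by (intro ennreal_powr_mono) auto
qed

section \<open>Mixed norms of indicators\<close>

text \<open>The common form of both norms of the theorem: \<open>k p\<close> is \<open>p\<close> for one and the conjugate exponent of
  \<open>p\<close> for the other, and \<open>N\<close> is the restriction of \<open>\<nu>\<close> to \<open>(a, b)\<close>.\<close>

definition mixed_norm ::
  "'a measure \<Rightarrow> real measure \<Rightarrow> (real \<Rightarrow> real) \<Rightarrow> real \<Rightarrow> ('a \<Rightarrow> real) \<Rightarrow> ennreal" where
  "mixed_norm \<mu> N k R f =
     ennreal_powr (\<integral>\<^sup>+p. ennreal_powr (lp_norm \<mu> (k p) f) R \<partial>N) (1 / R)"

text \<open>The \<open>R\<close>-th power of the mixed norm of the indicator of a set of measure \<open>d\<close>; the functions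
  \<open>\<Phi>\<close> and \<open>\<Psi>\<close> of the introduction are its two instances.\<close>

definition power_moment :: "real measure \<Rightarrow> (real \<Rightarrow> real) \<Rightarrow> real \<Rightarrow> real \<Rightarrow> real" where
  "power_moment N k R d = (LINT p|N. (d powr (1 / k p)) powr R)"

lemma igls_norm_eq_mixed_norm:
  assumes "sets \<nu> = sets borel"
  shows "igls_norm \<mu> \<nu> a b Q = mixed_norm \<mu> (restrict_space \<nu> {a<..<b}) (\<lambda>p. p) Q"
  using assms by (simp add: fun_eq_iff igls_norm_def mixed_norm_def nn_integral_restrict_space)

lemma conj_igls_norm_eq_mixed_norm:
  assumes "sets \<nu> = sets borel"
  shows "conj_igls_norm \<mu> \<nu> a b Q
    = mixed_norm \<mu> (restrict_space \<nu> {a<..<b}) conj_exp (conj_exp Q)"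
  using assms by (simp add: fun_eq_iff conj_igls_norm_def mixed_norm_def nn_integral_restrict_space)

locale exponent_family = finite_measure N for N :: "real measure" +
  fixes k :: "real \<Rightarrow> real" and R :: real
  assumes k_measurable [measurable]: "k \<in> borel_measurable N"
    and k_gt_1: "p \<in> space N \<Longrightarrow> 1 < k p"
    and R_pos: "0 < R"
begin

lemma integrable_power:
  assumes "0 < d"
  shows "integrable N (\<lambda>p. (d powr (1 / k p)) powr R)"
proof (rule integrable_const_bound[where B = "(max 1 d) powr R"])
  show "AE p in N. norm ((d powr (1 / k p)) powr R) \<le> max 1 d powr R"
  proof (rule AE_I2)
    fix p assume "p \<in> space N"
    then have p: "0 < 1 / k p" "1 / k p \<le> 1"
      using k_gt_1[of p] by auto
    have "d powr (1 / k p) \<le> max 1 d powr (1 / k p)"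
      using p assms by (intro powr_mono2) auto
    also have "\<dots> \<le> max 1 d powr 1"
      using p by (intro powr_mono) auto
    finally show "norm ((d powr (1 / k p)) powr R) \<le> max 1 d powr R"
      using R_pos by (simp add: powr_mono2)
  qed
qed measurable

lemma power_moment_pos:
  assumes "0 < d" "emeasure N (space N) \<noteq> 0"
  shows "0 < power_moment N k R d"
proof -
  have "power_moment N k R d \<noteq> 0"
  proof
    assume "power_moment N k R d = 0"
    then have "AE p in N. (d powr (1 / k p)) powr R = 0"
      using integral_nonneg_eq_0_iff_AE[OF integrable_power[OF assms(1)]]
      by (simp add: power_moment_def)
    then have "AE p in N. False"
      using assms(1) by simp
    then show False
      using assms(2) by (simp add: AE_iff_measurable[OF sets.top])
  qed
  moreover have "0 \<le> power_moment N k R d"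
    by (simp add: power_moment_def)
  ultimately show ?thesis
    by simp
qed

lemma mixed_norm_scaled_indicator:
  assumes A: "A \<in> sets \<mu>" "emeasure \<mu> A = ennreal d" and "0 < d" "0 \<le> c"
  shows "mixed_norm \<mu> N k R (\<lambda>x. c * indicator A x)
    = ennreal (c * power_moment N k R d powr (1 / R))"
proof -
  have "(\<integral>\<^sup>+p. ennreal_powr (lp_norm \<mu> (k p) (\<lambda>x. c * indicator A x)) R \<partial>N)
      = (\<integral>\<^sup>+p. ennreal (c powr R * (d powr (1 / k p)) powr R) \<partial>N)"
  proof (rule nn_integral_cong)
    fix p assume "p \<in> space N"
    then have "0 < k p"
      using k_gt_1[of p] by simp
    then show "ennreal_powr (lp_norm \<mu> (k p) (\<lambda>x. c * indicator A x)) R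
        = ennreal (c powr R * (d powr (1 / k p)) powr R)"
      using assms by (simp add: lp_norm_scaled_indicator ennreal_powr_ennreal powr_mult)
  qed
  also have "\<dots> = ennreal (c powr R * power_moment N k R d)"
    using integrable_power[OF assms(3)]
    by (subst nn_integral_eq_integral) (auto simp: power_moment_def)
  finally have "mixed_norm \<mu> N k R (\<lambda>x. c * indicator A x)
      = ennreal ((c powr R * power_moment N k R d) powr (1 / R))"
    by (simp add: mixed_norm_def ennreal_powr_ennreal power_moment_def)
  also have "(c powr R * power_moment N k R d) powr (1 / R) = c * power_moment N k R d powr (1 / R)"
    using assms R_pos by (simp add: powr_mult powr_powr power_moment_def)
  finally show ?thesis .
qed

text \<open>A mixed norm is monotone in the family of the norms \<open>|f|\<^sub>p\<close>, so averaging over \<open>A\<close> contracts it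
  as it contracts each of them.\<close>

lemma mixed_norm_average_le:
  assumes "A \<in> sets \<mu>" "emeasure \<mu> A = ennreal d" "f \<in> borel_measurable \<mu>" "0 \<le> d" "0 \<le> c"
    and "ennreal (c * d) \<le> (\<integral>\<^sup>+x. ennreal \<bar>f x\<bar> * indicator A x \<partial>\<mu>)"
  shows "mixed_norm \<mu> N k R (\<lambda>x. c * indicator A x) \<le> mixed_norm \<mu> N k R f"
  unfolding mixed_norm_def using R_pos k_gt_1 assms
  by (intro ennreal_powr_mono nn_integral_mono lp_norm_average_le) auto

text \<open>The normalised indicator of \<open>A\<close> gives the lower bound. For the upper bound, an \<open>f\<close> of norm \<open>1\<close>
  has an average over \<open>A\<close> whose multiple of the indicator still has norm at most \<open>1\<close>; so the mean of
  \<open>|f|\<close> over \<open>A\<close> is at most the reciprocal of the norm of the indicator.\<close>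

lemma assoc_norm_indicator:
  assumes A: "A \<in> sets \<mu>" "emeasure \<mu> A = ennreal d" and d: "0 < d"
    and N: "emeasure N (space N) \<noteq> 0"
  shows "assoc_norm \<mu> (mixed_norm \<mu> N k R) (indicator A)
    = ennreal (d / power_moment N k R d powr (1 / R))"
proof -
  define \<phi> where "\<phi> = power_moment N k R d powr (1 / R)"
  have \<phi>: "0 < \<phi>"
    using power_moment_pos[OF d N] by (simp add: \<phi>_def)
  note [measurable] = A(1)
  have lower: "\<exists>f\<in>{f \<in> borel_measurable \<mu>. mixed_norm \<mu> N k R f = 1}. ennreal (d / \<phi>) \<le>
     (if integrable \<mu> (\<lambda>x. f x * indicator A x)
        then ennreal \<bar>\<integral>x. f x * indicator A x \<partial>\<mu>\<bar> else \<infinity>)"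
  proof (rule bexI)
    have "mixed_norm \<mu> N k R (\<lambda>x. (1 / \<phi>) * indicator A x) = 1"
      using A d \<phi> by (subst mixed_norm_scaled_indicator) (auto simp flip: \<phi>_def)
    then show "(\<lambda>x. (1 / \<phi>) * indicator A x)
        \<in> {f \<in> borel_measurable \<mu>. mixed_norm \<mu> N k R f = 1}"
      by simp
    have "(\<lambda>x. (1 / \<phi>) * indicator A x * indicator A x) = (\<lambda>x. (1 / \<phi>) * (indicator A x :: real))"
      by (auto simp: fun_eq_iff indicator_def)
    moreover have "(\<integral>x. (1 / \<phi>) * indicator A x \<partial>\<mu>) = d / \<phi>"
      using A d by (simp add: measure_def)
    ultimately show "ennreal (d / \<phi>) \<le>
      (if integrable \<mu> (\<lambda>x. (1 / \<phi>) * indicator A x * indicator A x)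
        then ennreal \<bar>\<integral>x. (1 / \<phi>) * indicator A x * indicator A x \<partial>\<mu>\<bar> else \<infinity>)"
      using \<phi> d by simp
  qed
  have upper: "(if integrable \<mu> (\<lambda>x. f x * indicator A x)
        then ennreal \<bar>\<integral>x. f x * indicator A x \<partial>\<mu>\<bar> else \<infinity>) \<le> ennreal (d / \<phi>)"
    if f [measurable]: "f \<in> borel_measurable \<mu>" and f1: "mixed_norm \<mu> N k R f = 1" for f
  proof -
    define I where "I = (\<integral>\<^sup>+x. ennreal \<bar>f x\<bar> * indicator A x \<partial>\<mu>)"
    have c_le: "c \<le> 1 / \<phi>" if "0 \<le> c" "ennreal (c * d) \<le> I" for c
    proof -
      have "mixed_norm \<mu> N k R (\<lambda>x. c * indicator A x) \<le> 1"
        using mixed_norm_average_le[OF A f] that d f1 by (simp add: I_def)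
      then have "c * \<phi> \<le> 1"
        using mixed_norm_scaled_indicator[OF A d] that by (simp flip: \<phi>_def)
      then show ?thesis
        using \<phi> by (simp add: field_simps)
    qed
    \<comment> \<open>An infinite mean would admit every \<open>c\<close>, also one beyond the bound just shown.\<close>
    have "I \<noteq> \<infinity>"
      using c_le[of "1 / \<phi> + 1"] \<phi> by auto
    then obtain i where i: "I = ennreal i" "0 \<le> i"
      by (cases I) (auto simp: infinity_ennreal_def)
    have I_eq: "I = (\<integral>\<^sup>+x. ennreal (norm (f x * indicator A x)) \<partial>\<mu>)"
      unfolding I_def by (intro nn_integral_cong) (auto simp: indicator_def)
    have int: "integrable \<mu> (\<lambda>x. f x * indicator A x)"
    proof (rule integrableI_bounded)
      show "(\<integral>\<^sup>+x. ennreal (norm (f x * indicator A x)) \<partial>\<mu>) < \<infinity>"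
        unfolding I_eq[symmetric] using i by simp
    qed measurable
    have "i \<le> d / \<phi>"
      using c_le[of "i / d"] i d \<phi> by (simp add: field_simps)
    moreover have "ennreal \<bar>\<integral>x. f x * indicator A x \<partial>\<mu>\<bar> \<le> ennreal i"
      using integral_norm_bound_ennreal[OF int] I_eq i by simp
    ultimately show ?thesis
      using int by (auto intro: order.trans ennreal_leI)
  qed
  show ?thesis
    unfolding assoc_norm_def \<phi>_def[symmetric]
  proof (rule antisym)
    show "(SUP f\<in>{f \<in> borel_measurable \<mu>. mixed_norm \<mu> N k R f = 1}.
       if integrable \<mu> (\<lambda>x. f x * indicator A x)
        then ennreal \<bar>\<integral>x. f x * indicator A x \<partial>\<mu>\<bar> else \<infinity>) \<le> ennreal (d / \<phi>)"
      using upper by (intro SUP_least) blast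
  next
    show "ennreal (d / \<phi>) \<le> (SUP f\<in>{f \<in> borel_measurable \<mu>. mixed_norm \<mu> N k R f = 1}.
       if integrable \<mu> (\<lambda>x. f x * indicator A x)
        then ennreal \<bar>\<integral>x. f x * indicator A x \<partial>\<mu>\<bar> else \<infinity>)"
      using lower by (meson SUP_upper2)
  qed
qed

end

section \<open>The equality case of Hoelder's inequality\<close>

text \<open>For \<open>v = f\<^bsup>1/s\<^esup>\<close> and \<open>w = g\<^bsup>1/t\<^esup>\<close> the balance condition is \<open>f g = 1\<close>, so this is the equality
  case of Hoelder's inequality for two functions with constant product. Weighting
  \<open>ln v \<le> v - 1\<close> and \<open>ln w \<le> w - 1\<close> with \<open>s\<close> and \<open>t\<close> bounds \<open>s (v - 1) + t (w - 1)\<close> from below by \<open>0\<close>.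
  The integral of that function is \<open>0\<close>, so both bounds are equalities almost everywhere, and
  \<open>ln v = v - 1\<close> only at \<open>v = 1\<close>.\<close>

lemma AE_eq_1_of_log_balanced:
  fixes v w :: "'b \<Rightarrow> real"
  assumes st: "0 < s" "0 < t" "s + t = 1"
    and N: "measure N (space N) = 1"
    and int: "integrable N v" "integrable N w"
    and one: "(LINT p|N. v p) = 1" "(LINT p|N. w p) = 1"
    and pos: "\<And>p. p \<in> space N \<Longrightarrow> 0 < v p" "\<And>p. p \<in> space N \<Longrightarrow> 0 < w p"
    and bal: "\<And>p. p \<in> space N \<Longrightarrow> s * ln (v p) + t * ln (w p) = 0"
  shows "AE p in N. v p = 1"
proof -
  interpret finite_measure N
    using N by (intro finite_measureI) (auto simp: measure_def)
  define e where "e p = s * (v p - 1) + t * (w p - 1)" for p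
  have e_ge: "s * (v p - 1 - ln (v p)) \<le> e p" and v_ge: "0 \<le> v p - 1 - ln (v p)"
    if "p \<in> space N" for p
  proof -
    show "0 \<le> v p - 1 - ln (v p)"
      using ln_le_minus_one pos(1)[OF that] by auto
    have "0 \<le> t * (w p - 1 - ln (w p))"
      using ln_le_minus_one[OF pos(2)[OF that]] st by simp
    then show "s * (v p - 1 - ln (v p)) \<le> e p"
      using bal[OF that] by (simp add: e_def algebra_simps)
  qed
  have e_int: "integrable N e"
    unfolding e_def using int
    by (intro Bochner_Integration.integrable_add integrable_mult_right
        Bochner_Integration.integrable_diff) auto
  have "(LINT p|N. e p) = 0"
    unfolding e_def using int one N by simp
  moreover have "AE p in N. 0 \<le> e p"
    by (intro AE_I2) (meson e_ge v_ge less_imp_le mult_nonneg_nonneg order.trans st(1))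
  ultimately have "AE p in N. e p = 0"
    using integral_nonneg_eq_0_iff_AE[OF e_int] by simp
  then show ?thesis
  proof (rule AE_mp, intro AE_I2 impI)
    fix p assume p: "p \<in> space N" "e p = 0"
    then have "v p - 1 - ln (v p) = 0"
      using e_ge[OF p(1)] v_ge[OF p(1)] st by (simp add: mult_le_0_iff)
    then show "v p = 1"
      using ln_eq_minus_one[OF pos(1)[OF p(1)]] by simp
  qed
qed

text \<open>Hoelder's inequality bounds the product below by \<open>d\<close> times the mass of \<open>N\<close>. Equality with \<open>d\<close>
  at \<open>d = 1\<close> fixes the mass, and at one further \<open>d\<close> it makes Hoelder's inequality an equality.\<close>

lemma power_moments_not_tight:
  assumes id: "exponent_family N (\<lambda>p. p) Q" and co: "exponent_family N conj_exp (conj_exp Q)"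
    and Q: "1 < Q" and N: "emeasure N (space N) \<noteq> 0"
    and no_atoms: "\<And>r. AE p in N. p \<noteq> r"
  shows "\<exists>d>0. power_moment N (\<lambda>p. p) Q d powr (1 / Q)
      * power_moment N conj_exp (conj_exp Q) d powr (1 / conj_exp Q) \<noteq> d"
proof (rule ccontr)
  interpret id: exponent_family N "\<lambda>p. p" Q by fact
  interpret co: exponent_family N conj_exp "conj_exp Q" by fact
  define \<Phi> where "\<Phi> = power_moment N (\<lambda>p. p) Q"
  define \<Psi> where "\<Psi> = power_moment N conj_exp (conj_exp Q)"
  have Q': "0 < 1 / conj_exp Q" "1 / Q + 1 / conj_exp Q = 1"
    using Q by (auto simp: conj_exp_def field_simps)
  have pos: "0 < \<Phi> d" "0 < \<Psi> d" if "0 < d" for d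
    using id.power_moment_pos[OF that N] co.power_moment_pos[OF that N] by (auto simp: \<Phi>_def \<Psi>_def)
  assume "\<not> ?thesis"
  then have tight: "\<Phi> d powr (1 / Q) * \<Psi> d powr (1 / conj_exp Q) = d" if "0 < d" for d
    using that by (auto simp: \<Phi>_def \<Psi>_def)
  have "\<Phi> 1 = measure N (space N)" "\<Psi> 1 = measure N (space N)"
    by (auto simp: \<Phi>_def \<Psi>_def power_moment_def)
  moreover from this have "measure N (space N) \<noteq> 0"
    using pos(1)[of 1] by simp
  ultimately have mass: "measure N (space N) = 1"
    using tight[of 1] Q' by (simp flip: powr_add)
  \<comment> \<open>Any positive value other than \<open>1\<close> would do; this one has logarithm \<open>1\<close>.\<close>
  define e where "e = exp (1 :: real)"
  have e: "0 < e" "ln e = 1"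
    by (auto simp: e_def)
  have balance: "ln (\<Phi> e) / Q + ln (\<Psi> e) / conj_exp Q = 1"
    using arg_cong[OF tight[OF e(1)], of ln] pos[OF e(1)] e by (simp add: ln_mult ln_powr)
  have "AE p in N. (e powr (1 / p)) powr Q / \<Phi> e = 1"
  proof (rule AE_eq_1_of_log_balanced[where s = "1 / Q" and t = "1 / conj_exp Q"
        and w = "\<lambda>p. (e powr (1 / conj_exp p)) powr conj_exp Q / \<Psi> e"])
    fix p assume p: "p \<in> space N"
    have "1 / p + 1 / conj_exp p = 1"
      using id.k_gt_1[OF p] by (auto simp: conj_exp_def field_simps)
    moreover have "1 / Q * ln ((e powr (1 / p)) powr Q / \<Phi> e)
        + 1 / conj_exp Q * ln ((e powr (1 / conj_exp p)) powr conj_exp Q / \<Psi> e)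
      = 1 / p + 1 / conj_exp p - (ln (\<Phi> e) / Q + ln (\<Psi> e) / conj_exp Q)"
      using pos[OF e(1)] e Q id.R_pos co.R_pos
      by (simp add: ln_div ln_powr diff_divide_distrib)
    ultimately show "1 / Q * ln ((e powr (1 / p)) powr Q / \<Phi> e)
        + 1 / conj_exp Q * ln ((e powr (1 / conj_exp p)) powr conj_exp Q / \<Psi> e) = 0"
      using balance by simp
  qed (use Q Q' mass pos[OF e(1)] e id.integrable_power[OF e(1)] co.integrable_power[OF e(1)]
      in \<open>auto simp: \<Phi>_def \<Psi>_def power_moment_def\<close>)
  \<comment> \<open>The only solution \<open>p\<close> of \<open>e\<^bsup>Q/p\<^esup> = \<Phi> e\<close> is excluded by the absence of atoms.\<close>
  then have "AE p in N. False"
    using no_atoms[of "Q / ln (\<Phi> e)"]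
  proof (eventually_elim)
    case (elim p)
    then have "(e powr (1 / p)) powr Q = \<Phi> e"
      using pos[OF e(1)] by simp
    then have "Q / p = ln (\<Phi> e)"
      using e by (simp flip: \<open>(e powr (1 / p)) powr Q = \<Phi> e\<close> add: ln_powr)
    then show False
      using elim(2) Q by (cases "p = 0"; cases "ln (\<Phi> e) = 0") (auto simp: field_simps)
  qed
  then show False
    using N by (simp add: AE_iff_measurable[OF sets.top])
qed

section \<open>Integral Grand Lebesgue Spaces\<close>

theorem theorem6p2:
  fixes \<mu> :: "'a measure" and \<nu> :: "real measure" and h :: "real \<Rightarrow> real" and a b Q :: real
  assumes "sigma_finite_measure \<mu>"
    and "emeasure \<mu> (space \<mu>) \<noteq> 0"
    and "\<And>\<delta>::real. 0 < \<delta> \<Longrightarrow> \<exists>A\<in>sets \<mu>. emeasure \<mu> A = ennreal \<delta>"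
    and "1 < a" and "a < b" and "1 < Q"
    and "sets \<nu> = sets borel"
    and "\<And>B. B \<in> sets borel \<Longrightarrow> B \<subseteq> {a<..<b} \<Longrightarrow>
           emeasure \<nu> B = (\<integral>\<^sup>+p\<in>B. ennreal (h p) \<partial>lborel)"
    and "\<And>p. p \<in> {a<..<b} \<Longrightarrow> 0 < h p"
    and "continuous_on {a<..<b} h"
    and "h differentiable_on {a<..<b}"
    and "\<And>p. p \<in> {a..b} \<Longrightarrow> 0 \<le> h p"
    and "set_integrable lborel {a<..<b} h"
    and "continuous (at_right a) h \<or> continuous (at_left b) h"
    and "0 < h a" and "0 < h b"
  shows "\<not> coincide (conj_igls \<mu> \<nu> a b Q) (conj_igls_norm \<mu> \<nu> a b Q)
           (assoc_space \<mu> (igls_norm \<mu> \<nu> a b Q)) (assoc_norm \<mu> (igls_norm \<mu> \<nu> a b Q))"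
proof
  assume co: "coincide (conj_igls \<mu> \<nu> a b Q) (conj_igls_norm \<mu> \<nu> a b Q)
           (assoc_space \<mu> (igls_norm \<mu> \<nu> a b Q)) (assoc_norm \<mu> (igls_norm \<mu> \<nu> a b Q))"
  note sets_\<nu> = assms(7) and density = assms(8)
  define S where "S = {a<..<b}"
  define N where "N = restrict_space \<nu> S"
  have S: "S \<in> sets borel" "S \<in> sets \<nu>"
    using sets_\<nu> by (auto simp: S_def)
  have space_N: "space N = S"
    using S by (simp add: N_def space_restrict_space2)
  have em_N: "emeasure N B = emeasure \<nu> B" if "B \<subseteq> S" for B
    using that S unfolding N_def by (subst emeasure_restrict_space) (auto simp: sets.Int_space_eq2)
  have sets_N: "sets N = sets (restrict_space borel S)"
    unfolding N_def by (intro sets_restrict_space_cong sets_\<nu>)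
  have mass: "emeasure N (space N) = (\<integral>\<^sup>+p. ennreal (indicator S p * h p) \<partial>lborel)"
    using density[OF S(1)] em_N[of S] space_N
    by (auto simp: S_def indicator_def intro!: nn_integral_cong)
  have hS: "integrable lborel (\<lambda>p. indicator S p * h p)"
    using assms(13) by (simp add: set_integrable_def S_def)
  have h_nonneg: "0 \<le> indicator S p * h p" for p
    using assms(9)[of p] by (auto simp: S_def indicator_def)
  have "emeasure N (space N) \<noteq> \<infinity>"
    using hS h_nonneg mass by (simp add: nn_integral_eq_integral)
  then interpret finite_measure N
    by (rule finite_measureI)
  have N_nonnull: "emeasure N (space N) \<noteq> 0"
  proof
    assume "emeasure N (space N) = 0"
    then have "AE p in lborel. ennreal (indicator S p * h p) = 0"
      using hS mass by (simp add: nn_integral_0_iff_AE borel_measurable_integrable)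
    then have "AE p in lborel. p \<notin> S"
    proof (rule eventually_mono, intro notI)
      fix p assume "ennreal (indicator S p * h p) = 0" "p \<in> S"
      then show False
        using assms(9)[of p] by (simp add: S_def ennreal_eq_0_iff)
    qed
    then have "emeasure lborel S = 0"
      using S by (subst (asm) AE_iff_measurable[where N = S]) auto
    then show False
      using assms(5) by (simp add: S_def)
  qed
  have no_atoms: "AE p in N. p \<noteq> r" for r
  proof (rule AE_I)
    show "{p \<in> space N. \<not> p \<noteq> r} \<subseteq> {r} \<inter> S"
      using space_N by auto
    show "{r} \<inter> S \<in> sets N"
      unfolding sets_N sets_restrict_space by (rule image_eqI[of _ _ "{r}"]) auto
    have "AE p in lborel. ennreal (h p) * indicator ({r} \<inter> S) p = 0"
      using AE_lborel_singleton[of r] by (rule eventually_mono) simp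
    then have "(\<integral>\<^sup>+p\<in>{r} \<inter> S. ennreal (h p) \<partial>lborel) = (\<integral>\<^sup>+p. 0 \<partial>(lborel :: real measure))"
      by (rule nn_integral_cong_AE)
    moreover have "emeasure N ({r} \<inter> S) = (\<integral>\<^sup>+p\<in>{r} \<inter> S. ennreal (h p) \<partial>lborel)"
      unfolding em_N[OF Int_lower2] using S by (intro density) (simp_all add: S_def)
    ultimately show "emeasure N ({r} \<inter> S) = 0"
      by simp
  qed
  have gt1: "1 < p" if "p \<in> space N" for p
    using that assms(4) by (simp add: space_N S_def)
  have [measurable]: "(\<lambda>p. p) \<in> borel_measurable N" "conj_exp \<in> borel_measurable N"
    unfolding conj_exp_def[abs_def] measurable_cong_sets[OF sets_N refl]
    by (intro measurable_restrict_space1; measurable)+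
  have id_family: "exponent_family N (\<lambda>p. p) Q"
    using gt1 assms(6) by unfold_locales auto
  have conj_family: "exponent_family N conj_exp (conj_exp Q)"
    using gt1 assms(6) by unfold_locales (auto simp: conj_exp_def field_simps)
  have norms: "igls_norm \<mu> \<nu> a b Q = mixed_norm \<mu> N (\<lambda>p. p) Q"
    "conj_igls_norm \<mu> \<nu> a b Q = mixed_norm \<mu> N conj_exp (conj_exp Q)"
    using sets_\<nu> by (auto simp: igls_norm_eq_mixed_norm conj_igls_norm_eq_mixed_norm N_def S_def)
  obtain d where d: "0 < d" and neq: "power_moment N (\<lambda>p. p) Q d powr (1 / Q)
      * power_moment N conj_exp (conj_exp Q) d powr (1 / conj_exp Q) \<noteq> d"
    using power_moments_not_tight[OF id_family conj_family assms(6) N_nonnull no_atoms] by blast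
  obtain A where A: "A \<in> sets \<mu>" "emeasure \<mu> A = ennreal d"
    using assms(3)[OF d] by blast
  have conj_A: "conj_igls_norm \<mu> \<nu> a b Q (indicator A)
      = ennreal (power_moment N conj_exp (conj_exp Q) d powr (1 / conj_exp Q))"
    using exponent_family.mixed_norm_scaled_indicator[OF conj_family A d, of 1] norms by simp
  then have "(indicator A :: 'a \<Rightarrow> real) \<in> conj_igls \<mu> \<nu> a b Q"
    using A(1) by (simp add: conj_igls_def)
  with co have "conj_igls_norm \<mu> \<nu> a b Q (indicator A)
      = assoc_norm \<mu> (igls_norm \<mu> \<nu> a b Q) (indicator A)"
    by (simp add: coincide_def)
  then have "power_moment N conj_exp (conj_exp Q) d powr (1 / conj_exp Q)
      = d / power_moment N (\<lambda>p. p) Q d powr (1 / Q)"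
    using conj_A exponent_family.assoc_norm_indicator[OF id_family A d N_nonnull] norms d
    by (simp add: ennreal_inj)
  then show False
    using neq exponent_family.power_moment_pos[OF id_family d N_nonnull] by simp
qed

end
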